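(* Let $a\ge 0$ be an integer and, for $p\ge 0$, let $R_p(z)$ be the generating function, according to the number of internal nodes, of the weighted unary-binary trees (unary edges coloured with $a$ colours) with Horton-Strahler number equal to $p$. Under the substitution $z=\frac{u}{1+(a+2)u+u^2}$, one has for all $p\ge 0$ $$R_p(z)=\frac{1-u^2}{u}\,\frac{u^{2^p}}{1-u^{2^{p+1}}}.$$
   Context: Weighted unary-binary trees with parameter $a$ (a nonnegative integer) form the family $\mathscr{N}$ defined recursively: a tree in $\mathscr{N}$ is either the empty tree $\square$ (a leaf, of size $0$); or an internal node (root) with an ordered pair of subtrees (left, right), both in $\mathscr{N}$ (possibly empty); or an internal node with a single subtree that is a nonempty tree of $\mathscr{N}$, attached by a unary edge carrying one of $a$ colours. The size is the number of internal nodes, and $R_p(z)=\sum_t z^{|t|}$, summed over trees $t\in\mathscr{N}$ with $\mathrm{reg}(t)=p$, where $|t|$ is the size. The Horton-Strahler number $\mathrm{reg}$ of a tree is defined recursively: $\mathrm{reg}(\square)=0$; if the root has two subtrees $t_1,t_2$, then $\mathrm{reg}(t)=\max\{\mathrm{reg}(t_1),\mathrm{reg}(t_2)\}$ if $\mathrm{reg}(t_1)\ne\mathrm{reg}(t_2)$, and $\mathrm{reg}(t)=1+\mathrm{reg}(t_1)$ otherwise; if the root has a single (unary) subtree $t_1$, then $\mathrm{reg}(t)=\mathrm{reg}(t_1)$. The substitution is understood as an identity of formal power series in $u$ (equivalently, $u=u(z)$ is the formal power series with $u(0)=0$ satisfying $z=u/(1+(a+2)u+u^2)$). *)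

theory Defs
  imports "HOL-Computational_Algebra.Computational_Algebra"
begin

datatype ubtree = Leaf | Binary ubtree ubtree | Unary nat ubtree

text \<open>The colours of unary edges are the natural numbers below \<open>a\<close>.\<close>

inductive_set ubtrees :: "nat \<Rightarrow> ubtree set" for a :: nat where
  leaf: "Leaf \<in> ubtrees a"
| binary: "l \<in> ubtrees a \<Longrightarrow> r \<in> ubtrees a \<Longrightarrow> Binary l r \<in> ubtrees a"
| unary: "t \<in> ubtrees a \<Longrightarrow> t \<noteq> Leaf \<Longrightarrow> c < a \<Longrightarrow> Unary c t \<in> ubtrees a"

fun internal_nodes :: "ubtree \<Rightarrow> nat" where
  "internal_nodes Leaf = 0"
| "internal_nodes (Binary l r) = 1 + internal_nodes l + internal_nodes r"
| "internal_nodes (Unary c t) = 1 + internal_nodes t"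

text \<open>Horton-Strahler number\<close>

fun reg :: "ubtree \<Rightarrow> nat" where
  "reg Leaf = 0"
| "reg (Binary l r) = (if reg l \<noteq> reg r then max (reg l) (reg r) else 1 + reg l)"
| "reg (Unary c t) = reg t"

text \<open>The sets counted by the generating function are finite, so \<open>card\<close> is meaningful there.\<close>

lemma finite_ubtrees_of_size: "finite {t \<in> ubtrees a. internal_nodes t = n}"
proof (rule finite_subset)
  show "{t \<in> ubtrees a. internal_nodes t = n} \<subseteq> {t \<in> ubtrees a. internal_nodes t \<le> n}"
    by auto
  show "finite {t \<in> ubtrees a. internal_nodes t \<le> n}"
  proof (induction n)
    case 0
    have "{t \<in> ubtrees a. internal_nodes t \<le> 0} \<subseteq> {Leaf}"
    proof
      fix t assume "t \<in> {t \<in> ubtrees a. internal_nodes t \<le> 0}"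
      then show "t \<in> {Leaf}" by (cases t) simp_all
    qed
    then show ?case
      by (rule finite_subset) simp
  next
    case (Suc n)
    let ?S = "{t \<in> ubtrees a. internal_nodes t \<le> n}"
    have "{t \<in> ubtrees a. internal_nodes t \<le> Suc n} \<subseteq>
        {Leaf} \<union> case_prod Binary ` (?S \<times> ?S) \<union> case_prod Unary ` ({..<a} \<times> ?S)"
    proof
      fix t assume "t \<in> {t \<in> ubtrees a. internal_nodes t \<le> Suc n}"
      then have "t \<in> ubtrees a" "internal_nodes t \<le> Suc n" by simp_all
      then show "t \<in> {Leaf} \<union> case_prod Binary ` (?S \<times> ?S) \<union> case_prod Unary ` ({..<a} \<times> ?S)"
        by (cases rule: ubtrees.cases) auto
    qed
    then show ?case
      by (rule finite_subset) (use Suc in auto)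
  qed
qed

definition R :: "nat \<Rightarrow> nat \<Rightarrow> rat fps" where
  "R a p = Abs_fps (\<lambda>n. of_nat (card {t \<in> ubtrees a. reg t = p \<and> internal_nodes t = n}))"

text \<open>The power series \<open>z = u / (1 + (a + 2) u + u\<^sup>2)\<close> in the indeterminate \<open>u\<close>;
  the denominator is a unit. An identity involving \<open>(1 - u\<^sup>2) / u\<close> must be stated for Laurent
  series: in \<open>rat fps\<close> this quotient would be truncated to \<open>- u\<close>.\<close>

definition z_of_u :: "nat \<Rightarrow> rat fps" where
  "z_of_u a = fps_X / (1 + (of_nat a + 2) * fps_X + fps_X ^ 2)"

end

theory Submission
  imports Defs
begin

text \<open>
  Cutting a tree with Horton-Strahler number \<open>p + 1\<close> at its root leaves three possibilities: two
  subtrees with number \<open>p\<close>; one subtree with number \<open>p + 1\<close> and another with a smaller number, in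
  either order; or a unary edge above a tree with number \<open>p + 1\<close>, which is automatically nonempty.
  With \<open>L\<^sub>q = R\<^sub>0 + \<dots> + R\<^sub>q\<^sub>-\<^sub>1\<close> this reads
  \<open>R\<^sub>p\<^sub>+\<^sub>1 (1 - a z - 2 z L\<^sub>p\<^sub>+\<^sub>1) = z R\<^sub>p\<^sup>2\<close> (lemma \<open>R_Suc\<close>), a linear equation that determines
  \<open>R\<^sub>p\<^sub>+\<^sub>1\<close>.

  The substitution is chosen such that this recursion is solved by a telescoping sum: as
  \<open>v / (1 - v\<^sup>2) = 1 / (1 - v) - 1 / (1 - v\<^sup>2)\<close>, the claimed values of \<open>R\<^sub>0, \<dots>, R\<^sub>p\<close> add up to
  \<open>L\<^sub>p\<^sub>+\<^sub>1 = (1 - u\<^sup>2)/u (1/(1 - u) - 1/(1 - v))\<close> with \<open>v = u\<close> to the power \<open>2\<^sup>p\<^sup>+\<^sup>1\<close>.  Since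
  \<open>1/z = u + (a + 2) + 1/u\<close>, the factor \<open>1 - a z - 2 z L\<^sub>p\<^sub>+\<^sub>1\<close> then collapses to
  \<open>(z/u) (1 - u\<^sup>2) (1 + v)/(1 - v)\<close>, and division by it produces the claimed form of \<open>R\<^sub>p\<^sub>+\<^sub>1\<close>
  (lemma \<open>register_recursion_solution\<close>).  Closed forms for \<open>R\<^sub>p\<close> and \<open>L\<^sub>p\<close> are therefore proved by
  one simultaneous induction, carried out in the field of Laurent series.
\<close>

section \<open>Generating functions of sets of trees\<close>

definition tree_gf :: "ubtree set \<Rightarrow> rat fps" where
  "tree_gf A = Abs_fps (\<lambda>n. of_nat (card {t \<in> A. internal_nodes t = n}))"

lemma tree_gf_empty [simp]: "tree_gf {} = 0"
  by (simp add: tree_gf_def fps_eq_iff)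

lemma R_eq_tree_gf: "R a p = tree_gf {t \<in> ubtrees a. reg t = p}"
  by (simp add: R_def tree_gf_def conj_ac)

lemma finite_subset_of_size:
  assumes "A \<subseteq> ubtrees a"
  shows "finite {t \<in> A. internal_nodes t = n}"
  by (rule finite_subset[OF _ finite_ubtrees_of_size[of a n]]) (use assms in auto)

lemma tree_gf_Un:
  assumes "A \<subseteq> ubtrees a" "B \<subseteq> ubtrees a" "A \<inter> B = {}"
  shows "tree_gf (A \<union> B) = tree_gf A + tree_gf B"
proof (rule fps_ext)
  fix n
  have "{t \<in> A \<union> B. internal_nodes t = n} =
      {t \<in> A. internal_nodes t = n} \<union> {t \<in> B. internal_nodes t = n}"
    by auto
  also have "card \<dots> = card {t \<in> A. internal_nodes t = n} + card {t \<in> B. internal_nodes t = n}"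
    by (rule card_Un_disjoint) (use assms finite_subset_of_size in auto)
  finally show "tree_gf (A \<union> B) $ n = (tree_gf A + tree_gf B) $ n"
    by (simp add: tree_gf_def)
qed

lemma tree_gf_Binary:
  assumes A: "A \<subseteq> ubtrees a" and B: "B \<subseteq> ubtrees a"
  shows "tree_gf (case_prod Binary ` (A \<times> B)) = fps_X * (tree_gf A * tree_gf B)"
proof (rule fps_ext)
  fix n
  let ?T = "\<lambda>A n. {t \<in> A. internal_nodes t = n}"
  show "tree_gf (case_prod Binary ` (A \<times> B)) $ n = (fps_X * (tree_gf A * tree_gf B)) $ n"
  proof (cases n)
    case 0
    then show ?thesis
      by (auto simp: tree_gf_def card_eq_0_iff)
  next
    case (Suc m)
    have "?T (case_prod Binary ` (A \<times> B)) n =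
        case_prod Binary ` (\<Union>i\<in>{0..m}. ?T A i \<times> ?T B (m - i))"
      unfolding Suc by (force simp: image_iff)
    also have "card \<dots> = card (\<Union>i\<in>{0..m}. ?T A i \<times> ?T B (m - i))"
      by (rule card_image) (auto simp: inj_on_def)
    also have "\<dots> = (\<Sum>i=0..m. card (?T A i) * card (?T B (m - i)))"
      by (subst card_UN_disjoint)
        (use finite_subset_of_size[OF A] finite_subset_of_size[OF B] in
          \<open>auto simp: card_cartesian_product\<close>)
    finally have "tree_gf (case_prod Binary ` (A \<times> B)) $ n = (tree_gf A * tree_gf B) $ m"
      by (simp add: tree_gf_def fps_mult_nth)
    with Suc show ?thesis
      by (simp add: fps_X_mult_nth)
  qed
qed

lemma tree_gf_Unary:
  "tree_gf (case_prod Unary ` ({..<k} \<times> A)) = of_nat k * fps_X * tree_gf A"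
proof (rule fps_ext)
  fix n
  let ?T = "\<lambda>A n. {t \<in> A. internal_nodes t = n}"
  show "tree_gf (case_prod Unary ` ({..<k} \<times> A)) $ n = (of_nat k * fps_X * tree_gf A) $ n"
  proof (cases n)
    case 0
    then show ?thesis
      by (auto simp: tree_gf_def card_eq_0_iff mult.assoc)
  next
    case (Suc m)
    have "?T (case_prod Unary ` ({..<k} \<times> A)) n = case_prod Unary ` ({..<k} \<times> ?T A m)"
      unfolding Suc by (force simp: image_iff)
    also have "card \<dots> = card ({..<k} \<times> ?T A m)"
      by (rule card_image) (auto simp: inj_on_def)
    finally show ?thesis
      using Suc by (simp add: tree_gf_def mult.assoc card_cartesian_product fps_of_nat[symmetric])
  qed
qed

section \<open>The recursion for the Horton-Strahler number\<close>

definition L :: "nat \<Rightarrow> nat \<Rightarrow> rat fps" where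
  "L a p = tree_gf {t \<in> ubtrees a. reg t < p}"

lemma L_0: "L a 0 = 0"
  by (simp add: L_def)

lemma L_Suc: "L a (Suc p) = L a p + R a p"
proof -
  have "{t \<in> ubtrees a. reg t < Suc p} =
      {t \<in> ubtrees a. reg t < p} \<union> {t \<in> ubtrees a. reg t = p}"
    by auto
  then show ?thesis
    unfolding L_def R_eq_tree_gf by (subst tree_gf_Un[symmetric, of _ a]) auto
qed

lemma reg_eq_0_iff: "t \<in> ubtrees a \<Longrightarrow> reg t = 0 \<longleftrightarrow> t = Leaf"
  by (induction rule: ubtrees.induct) auto

lemma R_0: "R a 0 = 1"
proof -
  have "{t \<in> ubtrees a. reg t = 0 \<and> internal_nodes t = n} = (if n = 0 then {Leaf} else {})" for n
    using reg_eq_0_iff[of _ a] by (auto intro: ubtrees.leaf)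
  then show ?thesis
    by (simp add: R_def fps_eq_iff)
qed

lemma R_Suc:
  "R a (Suc p) = fps_X * (R a p * R a p) + 2 * fps_X * (R a (Suc p) * L a (Suc p))
    + of_nat a * fps_X * R a (Suc p)"
proof -
  let ?T = "\<lambda>p. {t \<in> ubtrees a. reg t = p}"
  let ?U = "{t \<in> ubtrees a. reg t < Suc p}"
  let ?A = "case_prod Binary ` (?T p \<times> ?T p)"
  let ?B = "case_prod Binary ` (?T (Suc p) \<times> ?U)"
  let ?C = "case_prod Binary ` (?U \<times> ?T (Suc p))"
  let ?D = "case_prod Unary ` ({..<a} \<times> ?T (Suc p))"
  have sub: "?A \<subseteq> ubtrees a" "?B \<subseteq> ubtrees a" "?C \<subseteq> ubtrees a" "?D \<subseteq> ubtrees a"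
    by (auto intro!: ubtrees.intros)
  have "?T (Suc p) = ?A \<union> ?B \<union> ?C \<union> ?D"
  proof (intro set_eqI iffI)
    fix t assume "t \<in> ?T (Suc p)"
    then have "t \<in> ubtrees a" and r: "reg t = Suc p" by auto
    then show "t \<in> ?A \<union> ?B \<union> ?C \<union> ?D"
    proof (cases rule: ubtrees.cases)
      case (binary l s)
      with r show ?thesis
        by (auto simp: image_iff max_def split: if_splits)
    qed auto
  qed (auto intro!: ubtrees.intros)
  then have "R a (Suc p) = tree_gf (?A \<union> ?B \<union> ?C \<union> ?D)"
    by (simp only: R_eq_tree_gf)
  also have "\<dots> = tree_gf ?A + tree_gf ?B + tree_gf ?C + tree_gf ?D"
    by (subst tree_gf_Un[of _ a], use sub in auto)+
  also have "\<dots> = fps_X * (R a p * R a p) + fps_X * (R a (Suc p) * L a (Suc p))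
      + fps_X * (L a (Suc p) * R a (Suc p)) + of_nat a * fps_X * R a (Suc p)"
    unfolding R_eq_tree_gf L_def by (subst tree_gf_Binary[of _ a] tree_gf_Unary; auto)+
  finally show ?thesis
    by (simp add: algebra_simps)
qed

section \<open>Substitution and solution of the recursion\<close>

lemma z_of_u_mult: "z_of_u a * (1 + (of_nat a + 2) * fps_X + fps_X ^ 2) = fps_X"
proof -
  let ?D = "1 + (of_nat a + 2) * fps_X + fps_X ^ 2 :: rat fps"
  have "?D $ 0 \<noteq> 0" by simp
  then have "?D dvd fps_X"
    by (meson fps_is_unit_iff unit_imp_dvd)
  then show ?thesis
    unfolding z_of_u_def by (rule dvd_div_mult_self)
qed

lemma z_of_u_nth_0: "z_of_u a $ 0 = 0"
  using arg_cong[OF z_of_u_mult[of a], of "\<lambda>f. f $ 0"] by simp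

lemma fps_numeral_compose [simp]: "numeral k oo f = (numeral k :: 'a :: comm_ring_1 fps)"
  by (simp add: numeral_fps_const)

lemma fps_of_nat_compose [simp]: "of_nat k oo f = (of_nat k :: 'a :: comm_ring_1 fps)"
  by (simp add: fps_of_nat[symmetric])

text \<open>
  One step of the recursion, with \<open>r\<close>, \<open>M\<close> and \<open>s\<close> in the roles of \<open>R\<^sub>p\<close>, \<open>L\<^sub>p\<^sub>+\<^sub>1\<close> and
  \<open>R\<^sub>p\<^sub>+\<^sub>1\<close>, and \<open>w\<close> in that of \<open>u\<close> to the power \<open>2\<^sup>p\<close>.  Everything rests on the factorisation of
  \<open>1 - a z - 2 z M\<close>, in which the parameter \<open>a\<close> cancels.
\<close>
lemma register_recursion_solution:
  fixes x z w a r s M :: "'a :: field"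
  assumes x: "x \<noteq> 0" "1 - x\<^sup>2 \<noteq> 0" and w: "1 - (w\<^sup>2)\<^sup>2 \<noteq> 0"
    and z: "z * (1 + (a + 2) * x + x\<^sup>2) = x"
    and r: "r = (1 - x\<^sup>2) / x * (w / (1 - w\<^sup>2))"
    and M: "M = (1 - x\<^sup>2) / x * (1 / (1 - x) - 1 / (1 - w\<^sup>2))"
    and s: "s = z * (r * r) + 2 * z * (s * M) + a * z * s"
  shows "s = (1 - x\<^sup>2) / x * (w\<^sup>2 / (1 - (w\<^sup>2)\<^sup>2))"
proof -
  define v where "v = w\<^sup>2"
  have "1 - v\<^sup>2 = (1 - v) * (1 + v)" "1 - x\<^sup>2 = (1 - x) * (1 + x)"
    by (simp_all add: power2_eq_square algebra_simps)
  with w x have v: "1 - v \<noteq> 0" "1 + v \<noteq> 0" "1 - x \<noteq> 0"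
    by (auto simp: v_def)
  from z x have z0: "z \<noteq> 0" by auto
  have "x * M = (1 - x\<^sup>2) / (1 - x) - (1 - x\<^sup>2) / (1 - v)"
    unfolding M v_def times_divide_eq_left right_diff_distrib using x by simp
  also have "(1 - x\<^sup>2) / (1 - x) = 1 + x"
    using v by (simp add: field_simps power2_eq_square)
  finally have xM: "x * M = (1 + x) - (1 - x\<^sup>2) / (1 - v)" .
  have "x * (1 - a * z - 2 * z * M) = x - a * x * z - 2 * z * (x * M)"
    by (simp add: algebra_simps)
  also have "\<dots> = x - a * x * z - 2 * z * ((1 + x) - (1 - x\<^sup>2) / (1 - v))"
    by (simp only: xM)
  also have "\<dots> = z * ((1 + (a + 2) * x + x\<^sup>2) - a * x - 2 * ((1 + x) - (1 - x\<^sup>2) / (1 - v)))"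
    by (subst (1) z[symmetric]) (simp add: algebra_simps)
  also have "\<dots> = z * ((1 - x\<^sup>2) * (1 + v) / (1 - v))"
    using v by (simp add: field_simps power2_eq_square)
  finally have fac: "x * (1 - a * z - 2 * z * M) = z * ((1 - x\<^sup>2) * (1 + v) / (1 - v))" .
  have "s * (1 - a * z - 2 * z * M) = z * (r * r)"
    using s by (simp add: algebra_simps)
  then have "s * (x * (1 - a * z - 2 * z * M)) = x * (z * (r * r))"
    by (simp add: mult.left_commute[of s])
  then have "z * (s * ((1 - x\<^sup>2) * (1 + v) / (1 - v))) = z * (x * (r * r))"
    unfolding fac by (simp add: algebra_simps)
  then have "s * ((1 - x\<^sup>2) * (1 + v) / (1 - v)) = x * (r * r)"
    by (simp only: mult_left_cancel[OF z0])
  also have "x * (r * r) = (1 - x\<^sup>2) * ((1 - x\<^sup>2) * v) / (x * (1 - v) * (1 - v))"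
  proof -
    have "x * ((c / x * (w / d)) * (c / x * (w / d))) = c * (c * w\<^sup>2) / (x * d * d)" for c d
      using x by (simp add: power2_eq_square mult_ac)
    then show ?thesis
      unfolding r v_def .
  qed
  finally have "s * ((1 - x\<^sup>2) * (1 + v) / (1 - v)) =
      (1 - x\<^sup>2) * ((1 - x\<^sup>2) * v) / (x * (1 - v) * (1 - v))" .
  moreover have "s = s * (c * (1 + v) / (1 - v)) * ((1 - v) / (c * (1 + v)))" if "c \<noteq> 0" for c
    using v that by simp
  ultimately have "s = (1 - x\<^sup>2) * ((1 - x\<^sup>2) * v) / (x * (1 - v) * (1 - v))
      * ((1 - v) / ((1 - x\<^sup>2) * (1 + v)))"
    using x by metis
  also have "\<dots> = (1 - x\<^sup>2) / x * (v / ((1 - v) * (1 + v)))"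
    using x v by simp
  also have "(1 - v) * (1 + v) = 1 - v\<^sup>2"
    by (simp add: power2_eq_square algebra_simps)
  finally show ?thesis
    by (simp add: v_def)
qed

lemma one_minus_fls_X_power_nonzero:
  assumes "k > 0"
  shows "1 - fls_X ^ k \<noteq> (0 :: 'a :: field fls)"
proof
  assume "1 - fls_X ^ k = (0 :: 'a fls)"
  then have "fls_nth (1 - fls_X ^ k :: 'a fls) 0 = 0"
    by simp
  with assms show False
    by (simp add: fls_X_power_nth)
qed

text \<open>
  The induction step for \<open>R\<^sub>p\<^sub>+\<^sub>1\<close> needs the closed form of \<open>L\<^sub>p\<^sub>+\<^sub>1\<close>, hence the shift between the
  two indices.
\<close>
lemma R_and_L_closed_form:
  fixes a p :: nat
  defines "S \<equiv> \<lambda>f. fps_to_fls (f oo z_of_u a)"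
  shows "S (R a p) = (1 - fls_X\<^sup>2) / fls_X * (fls_X ^ 2 ^ p / (1 - fls_X ^ 2 ^ Suc p)) \<and>
    S (L a (Suc p)) = (1 - fls_X\<^sup>2) / fls_X * (1 / (1 - fls_X) - 1 / (1 - fls_X ^ 2 ^ Suc p))"
proof -
  define x where "x = (fls_X :: rat fls)"
  have x: "x \<noteq> 0" "1 - x\<^sup>2 \<noteq> 0" "1 - x \<noteq> 0"
    using one_minus_fls_X_power_nonzero[of 2] one_minus_fls_X_power_nonzero[of 1]
    by (auto simp: x_def)
  have pow: "1 - x ^ 2 ^ q \<noteq> 0" for q
    unfolding x_def by (rule one_minus_fls_X_power_nonzero) simp
  have sq: "x ^ 2 ^ Suc q = (x ^ 2 ^ q)\<^sup>2" for q
    by (simp add: power_mult[symmetric] mult.commute)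
  have telescope: "v / (1 - v\<^sup>2) = 1 / (1 - v) - 1 / (1 - v\<^sup>2)"
    if "1 - v \<noteq> 0" "1 - v\<^sup>2 \<noteq> 0" for v :: "rat fls"
  proof -
    have prod: "1 - v\<^sup>2 = (1 - v) * (1 + v)"
      by (simp add: power2_eq_square algebra_simps)
    with that have "1 / (1 - v) = (1 + v) / (1 - v\<^sup>2)"
      by auto
    then show ?thesis
      by (simp add: diff_divide_distrib[symmetric])
  qed
  have add: "S (f + g) = S f + S g" for f g
    by (simp add: S_def fps_compose_add_distrib fps_to_fls_plus)
  have mult: "S (f * g) = S f * S g" for f g
    by (simp add: S_def fps_compose_mult_distrib z_of_u_nth_0 fls_times_fps_to_fls)
  have atoms: "S 2 = 2" "S (of_nat a) = of_nat a" "S fps_X = fps_to_fls (z_of_u a)"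
    by (simp_all add: S_def z_of_u_nth_0 fps_X_fps_compose_startby0)
  have z: "S fps_X * (1 + (of_nat a + 2) * x + x\<^sup>2) = x"
    using arg_cong[OF z_of_u_mult[of a], of fps_to_fls]
    by (simp add: atoms x_def fls_times_fps_to_fls fps_to_fls_plus fps_to_fls_power)
  have "S (R a p) = (1 - x\<^sup>2) / x * (x ^ 2 ^ p / (1 - x ^ 2 ^ Suc p)) \<and>
    S (L a (Suc p)) = (1 - x\<^sup>2) / x * (1 / (1 - x) - 1 / (1 - x ^ 2 ^ Suc p))"
  proof (induction p)
    case 0
    have "S (R a 0) = 1" "S (L a (Suc 0)) = 1"
      by (simp_all add: L_Suc L_0 R_0 S_def)
    moreover have "1 = (1 - x\<^sup>2) / x * (x / (1 - x\<^sup>2))"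
      using x by simp
    ultimately show ?case
      using telescope[of x] x by (simp del: times_divide_eq_left times_divide_eq_right)
  next
    case (Suc p)
    let ?w = "x ^ 2 ^ p"
    have R: "S (R a (Suc p)) = (1 - x\<^sup>2) / x * (?w\<^sup>2 / (1 - (?w\<^sup>2)\<^sup>2))"
    proof (rule register_recursion_solution)
      show "S (R a p) = (1 - x\<^sup>2) / x * (?w / (1 - ?w\<^sup>2))"
        "S (L a (Suc p)) = (1 - x\<^sup>2) / x * (1 / (1 - x) - 1 / (1 - ?w\<^sup>2))"
        using Suc unfolding sq by simp_all
      show "S (R a (Suc p)) = S fps_X * (S (R a p) * S (R a p))
          + 2 * S fps_X * (S (R a (Suc p)) * S (L a (Suc p)))
          + of_nat a * S fps_X * S (R a (Suc p))"
        using arg_cong[OF R_Suc[of a p], of S] by (simp only: add mult atoms)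
      show "1 - (?w\<^sup>2)\<^sup>2 \<noteq> 0"
        using pow[of "Suc (Suc p)"] unfolding sq .
    qed (use x z in auto)
    also have "?w\<^sup>2 / (1 - (?w\<^sup>2)\<^sup>2) = 1 / (1 - ?w\<^sup>2) - 1 / (1 - (?w\<^sup>2)\<^sup>2)"
      by (rule telescope) (use pow[of "Suc p"] pow[of "Suc (Suc p)"] in \<open>unfold sq\<close>)
    finally have "S (R a (Suc p)) = (1 - x\<^sup>2) / x * (1 / (1 - ?w\<^sup>2) - 1 / (1 - (?w\<^sup>2)\<^sup>2))" .
    moreover have "S (L a (Suc p)) = (1 - x\<^sup>2) / x * (1 / (1 - x) - 1 / (1 - ?w\<^sup>2))"
      using Suc unfolding sq by blast
    ultimately have "S (L a (Suc (Suc p))) = (1 - x\<^sup>2) / x * (1 / (1 - x) - 1 / (1 - (?w\<^sup>2)\<^sup>2))"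
      by (simp only: L_Suc[of a "Suc p"] add distrib_left[symmetric]) simp
    with R show ?case
      unfolding sq by blast
  qed
  then show ?thesis
    by (simp only: x_def)
qed

theorem mainTheorem2:
  fixes a p :: nat
  shows "fps_to_fls (fps_compose (R a p) (z_of_u a)) =
    (1 - fls_X ^ 2) / fls_X * (fls_X ^ (2 ^ p) / (1 - fls_X ^ (2 ^ (p + 1))))"
  using R_and_L_closed_form[of a p] by simp

end
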